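(* Let $\Gamma\subset\mathbb{R}^n$ be an open symmetric convex cone with vertex at the origin, with $\partial\Gamma\neq\emptyset$ and $\Gamma_n\subseteq\Gamma$. Then $\kappa_\Gamma=\widetilde\kappa_\Gamma$.
   Context: $\Gamma_n=\{\lambda\in\mathbb{R}^n:\lambda_i>0\ \forall i\}$. "Symmetric" means invariant under permutations of coordinates. $\kappa_\Gamma=\max\{k:(\underbrace{0,\cdots,0}_{k},\underbrace{1,\cdots,1}_{n-k})\in\Gamma\}$. $\widetilde\kappa_\Gamma=\max\{k:(-\alpha_1,\cdots,-\alpha_k,\alpha_{k+1},\cdots,\alpha_n)\in\Gamma\text{ for some }\alpha_j>0,\ 1\leq j\leq n\}$, i.e. the maximal number of negative components of vectors of this form in $\Gamma$. *)

theory Defs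
  imports "HOL-Analysis.Analysis"
begin

text \<open>
  Vectors of dimension n are modelled as elements of \<open>real ^ 'n\<close> with \<open>n = CARD('n)\<close>. The index
  type carries a linear order, so that its elements are the first, ..., the n-th coordinate;
  \<open>coord_pos i\<close> is the position of \<open>i\<close>, running through \<open>1, ..., n\<close>.
\<close>

definition coord_pos :: "'n::{finite,linorder} \<Rightarrow> nat" where
  "coord_pos i = card {j. j \<le> i}"

definition positive_orthant :: "(real ^ 'n) set" where
  "positive_orthant = {x. \<forall>i. x $ i > 0}"

definition symmetric_set :: "(real ^ 'n) set \<Rightarrow> bool" where
  "symmetric_set \<Gamma> \<longleftrightarrow> (\<forall>\<sigma>. \<sigma> permutes UNIV \<longrightarrow> (\<forall>x\<in>\<Gamma>. (\<chi> i. x $ \<sigma> i) \<in> \<Gamma>))"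

text \<open>
  Only positive multiples are required: the library predicates \<open>cone\<close> and \<open>conic\<close> also admit the
  factor 0, and an open set containing 0 and closed under positive multiples is the whole space.
\<close>

definition cone_at_origin :: "'a::real_vector set \<Rightarrow> bool" where
  "cone_at_origin \<Gamma> \<longleftrightarrow> (\<forall>x\<in>\<Gamma>. \<forall>t>0. t *\<^sub>R x \<in> \<Gamma>)"

text \<open>
  In both definitions k ranges over \<open>0, ..., n\<close>, so the sets are finite; they contain 0 as soon as
  \<open>\<Gamma>\<close> contains the positive orthant, so that \<open>Max\<close> is then a genuine maximum.
\<close>

definition kappa :: "(real ^ 'n::{finite,linorder}) set \<Rightarrow> nat" where
  "kappa \<Gamma> = Max {k. k \<le> CARD('n) \<and> (\<chi> i. if coord_pos i \<le> k then 0 else 1) \<in> \<Gamma>}"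

definition kappa_tilde :: "(real ^ 'n::{finite,linorder}) set \<Rightarrow> nat" where
  "kappa_tilde \<Gamma> = Max {k. k \<le> CARD('n) \<and>
     (\<exists>\<alpha> :: 'n \<Rightarrow> real. (\<forall>j. \<alpha> j > 0) \<and> (\<chi> i. if coord_pos i \<le> k then - \<alpha> i else \<alpha> i) \<in> \<Gamma>)}"

end

theory Submission
  imports Defs
begin

text \<open>
  The two maxima agree because the sets of admissible \<open>k\<close> agree. If \<open>(0,\<dots>,0,1,\<dots>,1)\<close> lies in the
  open set \<open>\<Gamma>\<close>, its zeros can be lowered to a small \<open>-\<epsilon>\<close>. Conversely, \<open>\<Gamma>\<close> absorbs the addition of
  vectors of the positive orthant; adding \<open>(\<alpha>\<^sub>1,\<dots>,\<alpha>\<^sub>k,M - \<alpha>\<^bsub>k+1\<^esub>,\<dots>,M - \<alpha>\<^sub>n)\<close> with \<open>M\<close> large turns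
  \<open>(-\<alpha>\<^sub>1,\<dots>,-\<alpha>\<^sub>k,\<alpha>\<^bsub>k+1\<^esub>,\<dots>,\<alpha>\<^sub>n)\<close> into \<open>M\<close> times \<open>(0,\<dots>,0,1,\<dots>,1)\<close>.
\<close>

text \<open>The sum is twice the midpoint of \<open>x\<close> and \<open>y\<close>.\<close>

lemma convex_cone_add:
  assumes "convex \<Gamma>" "cone_at_origin \<Gamma>" "x \<in> \<Gamma>" "y \<in> \<Gamma>"
  shows "x + y \<in> \<Gamma>"
proof -
  have "(1/2) *\<^sub>R x + (1/2) *\<^sub>R y \<in> \<Gamma>"
    using assms by (intro convexD) auto
  then have "2 *\<^sub>R ((1/2) *\<^sub>R x + (1/2) *\<^sub>R y) \<in> \<Gamma>"
    using assms(2) unfolding cone_at_origin_def by (meson zero_less_numeral)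
  then show ?thesis by (simp add: scaleR_add_right)
qed

lemma open_diff_scaleR_mem:
  fixes x v :: "'a::real_normed_vector"
  assumes "open \<Gamma>" "x \<in> \<Gamma>"
  obtains \<epsilon> where "\<epsilon> > 0" "x - \<epsilon> *\<^sub>R v \<in> \<Gamma>"
proof -
  \<comment> \<open>The limit is one-sided so that the witness can be taken positive.\<close>
  have "((\<lambda>t. x - t *\<^sub>R v) \<longlongrightarrow> x - 0 *\<^sub>R v) (at_right 0)"
    by (intro tendsto_intros)
  then have "eventually (\<lambda>t. x - t *\<^sub>R v \<in> \<Gamma>) (at_right 0)"
    using assms by (intro topological_tendstoD) auto
  with eventually_at_right_less[of "0::real"]
  have "eventually (\<lambda>t. 0 < t \<and> x - t *\<^sub>R v \<in> \<Gamma>) (at_right 0)"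
    by (rule eventually_conj)
  then show ?thesis
    using that eventually_happens'[OF trivial_limit_at_right_real] by blast
qed

lemma zero_one_mem_iff_signed_mem:
  fixes \<Gamma> :: "(real ^ 'n) set"
  assumes "open \<Gamma>" "convex \<Gamma>" "cone_at_origin \<Gamma>" "positive_orthant \<subseteq> \<Gamma>"
  shows "(\<chi> i. if P i then 0 else 1) \<in> \<Gamma> \<longleftrightarrow>
    (\<exists>\<alpha>. (\<forall>j. \<alpha> j > 0) \<and> (\<chi> i. if P i then - \<alpha> i else \<alpha> i) \<in> \<Gamma>)"
    (is "?e \<in> \<Gamma> \<longleftrightarrow> ?R")
proof
  assume "?e \<in> \<Gamma>"
  then obtain \<epsilon> where \<epsilon>: "\<epsilon> > 0" "?e - \<epsilon> *\<^sub>R (\<chi> i. if P i then 1 else 0) \<in> \<Gamma>"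
    using open_diff_scaleR_mem assms(1) by blast
  define \<alpha> where "\<alpha> i = (if P i then \<epsilon> else 1)" for i
  have "?e - \<epsilon> *\<^sub>R (\<chi> i. if P i then 1 else 0) = (\<chi> i. if P i then - \<alpha> i else \<alpha> i)"
    by (simp add: vec_eq_iff \<alpha>_def)
  moreover have "\<forall>j. \<alpha> j > 0" using \<epsilon> by (simp add: \<alpha>_def)
  ultimately show ?R using \<epsilon>(2) by metis
next
  assume ?R
  then obtain \<alpha> where pos: "\<And>j. \<alpha> j > 0"
    and mem: "(\<chi> i. if P i then - \<alpha> i else \<alpha> i) \<in> \<Gamma>" (is "?x \<in> \<Gamma>")
    by blast
  \<comment> \<open>The summand 1 makes \<open>M\<close> strictly exceed every
    \<open>\<alpha> j\<close>, so that \<open>?p\<close> below is strictly positive.\<close>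
  define M where "M = 1 + Max (range \<alpha>)"
  have less: "\<alpha> j < M" for j
  proof -
    have "\<alpha> j \<le> Max (range \<alpha>)" by (rule Max_ge) auto
    then show ?thesis unfolding M_def by linarith
  qed
  then have M: "M > 0" using pos less_trans by blast
  let ?p = "(\<chi> i. if P i then \<alpha> i else M - \<alpha> i) :: real ^ 'n"
  have "?p \<in> positive_orthant"
    using pos less by (simp add: positive_orthant_def)
  then have "?x + ?p \<in> \<Gamma>"
    using assms mem by (blast intro: convex_cone_add)
  then have "(1 / M) *\<^sub>R (?x + ?p) \<in> \<Gamma>"
    using assms(3) M by (simp add: cone_at_origin_def)
  moreover have "(1 / M) *\<^sub>R (?x + ?p) = ?e"
    using M by (simp add: vec_eq_iff)
  ultimately show "?e \<in> \<Gamma>" by simp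
qed

theorem proposition2p5:
  fixes \<Gamma> :: "(real ^ 'n::{finite,linorder}) set"
  assumes "open \<Gamma>"
    and "symmetric_set \<Gamma>"
    and "convex \<Gamma>"
    and "cone_at_origin \<Gamma>"
    and "frontier \<Gamma> \<noteq> {}"
    and "positive_orthant \<subseteq> \<Gamma>"
  shows "kappa \<Gamma> = kappa_tilde \<Gamma>"
  unfolding kappa_def kappa_tilde_def
  \<comment> \<open>With \<open>P i\<close> as \<open>coord_pos i \<le> k\<close>, rewriting for
    each \<open>k\<close> makes the two sets under \<open>Max\<close> identical.\<close>
  by (simp add: zero_one_mem_iff_signed_mem assms)

end
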